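(* For every integer $k\geqslant 2$, there are positive constants $c$, $C$ and $n_0\in\mathbb{N}$ such that for every non-decreasing function $f:\mathbb{N}\to\mathbb{N}$ with $n\leqslant f(n)\leqslant R(K_n)$ for all $n$, there is a sequence of connected graphs $(G_n)_{n\in\mathbb{N}}$ with $|V(G_n)|=n$ such that $c f(n)\leqslant R(G_n)\leqslant C f(n)$ for all $n\in\mathbb{N}$. Moreover, $\chi(G_n)\geqslant k$ for every $n\geqslant n_0$.
   Context: For a graph $G$, the Ramsey number $R(G)$ is the smallest integer $N$ such that every two-colouring of the edges of the complete graph $K_N$ contains a monochromatic copy of $G$. $\chi(G)$ denotes the chromatic number of $G$. *)

theory Defs
  imports Complex_Main
begin

text \<open>Finite simple graphs are given by a vertex set V and an edge set E of 2-element subsets of V.\<close>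

definition graph_on :: "'a set \<Rightarrow> 'a set set \<Rightarrow> bool" where
  "graph_on V E \<longleftrightarrow> finite V \<and> (\<forall>e\<in>E. e \<subseteq> V \<and> card e = 2)"

definition adj_rel :: "'a set set \<Rightarrow> ('a \<times> 'a) set" where
  "adj_rel E = {(x, y). {x, y} \<in> E}"

definition connected_graph :: "'a set \<Rightarrow> 'a set set \<Rightarrow> bool" where
  "connected_graph V E \<longleftrightarrow> (\<forall>u\<in>V. \<forall>v\<in>V. (u, v) \<in> (adj_rel E)\<^sup>*)"

definition complete_graph_edges :: "nat \<Rightarrow> nat set set" where
  "complete_graph_edges n = {e. e \<subseteq> {..<n} \<and> card e = 2}"

text \<open>Proper colouring with k colours and the chromatic number.\<close>

definition colourable :: "'a set \<Rightarrow> 'a set set \<Rightarrow> nat \<Rightarrow> bool" where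
  "colourable V E k \<longleftrightarrow> (\<exists>c. c ` V \<subseteq> {..<k} \<and> (\<forall>u\<in>V. \<forall>v\<in>V. {u, v} \<in> E \<longrightarrow> c u \<noteq> c v))"

definition chromatic_number :: "'a set \<Rightarrow> 'a set set \<Rightarrow> nat" where
  "chromatic_number V E = (LEAST k. colourable V E k)"

text \<open>A two-colouring of the edges of K_N is a map col from (2-element) sets of vertices
  in {..<N} to bool. A monochromatic copy of G = (V,E) is an injective map of V into {..<N}
  sending every edge of G to an edge of the same colour.\<close>

definition mono_copy :: "'a set \<Rightarrow> 'a set set \<Rightarrow> nat \<Rightarrow> (nat set \<Rightarrow> bool) \<Rightarrow> bool" where
  "mono_copy V E N col \<longleftrightarrow>
     (\<exists>\<phi> b. inj_on \<phi> V \<and> \<phi> ` V \<subseteq> {..<N} \<and> (\<forall>e\<in>E. col (\<phi> ` e) = b))"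

definition ramsey_number :: "'a set \<Rightarrow> 'a set set \<Rightarrow> nat" where
  "ramsey_number V E = (LEAST N. \<forall>col. mono_copy V E N col)"

end

theory Submission
  imports Defs
begin

text \<open>
  Take $G_n$ to be a clique $K_s$ with $n - s$ pendant edges at one of its vertices. Its Ramsey number
  is $R(K_s) + O(s n)$ from above (a vertex of degree at least $n - 1$ in the colour of a monochromatic
  $K_s$ supplies the pendant edges, and if too many vertices have small degree in one colour then a
  greedy choice yields a $K_s$ in the other), and at least $\max(R(K_s), (s-1)(n-1))$ from below. Hence
  letting $s$ grow from $k$ to $n$ sweeps the range from $O(n)$ to $R(K_n)$ in steps of bounded
  ratio, as soon as $R(K_{s+1}) = O(R(K_s))$.

  For the latter, consider a colouring of $N$ vertices without a monochromatic $K_{s+1}$. For any two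
  vertices $u$, $v$, the red neighbourhood of $v$ and the blue neighbourhood of $u$ meet in fewer
  than $R(K_s)$ vertices. If $N$ is much larger than $R(K_s)$, then all red neighbourhoods nearly
  agree, and double counting shows that one colour has maximum degree at most a small fraction of $N$.
  By an argument of Erdos and Szemeredi such an unbalanced colouring contains a monochromatic clique
  larger than the generic logarithmic bound, which contradicts the exponential growth of $R(K_s)$.
\<close>

subsection \<open>Monochromatic cliques\<close>

definition mono_clique :: "('a set \<Rightarrow> bool) \<Rightarrow> bool \<Rightarrow> 'a set \<Rightarrow> bool" where
  "mono_clique col b S \<longleftrightarrow> (\<forall>u\<in>S. \<forall>v\<in>S. u \<noteq> v \<longrightarrow> col {u, v} = b)"

text \<open>The vertex \<open>v\<close> may lie outside \<open>V\<close>, which covers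
  neighbourhoods inside a set that does not contain it. \<open>v\<close> itself is excluded because
  \<open>col\<close> is arbitrary on singletons.\<close>

definition nbhd :: "('a set \<Rightarrow> bool) \<Rightarrow> bool \<Rightarrow> 'a set \<Rightarrow> 'a \<Rightarrow> 'a set" where
  "nbhd col b V v = {u \<in> V. u \<noteq> v \<and> col {v, u} = b}"

lemma nbhd_subset: "nbhd col b V v \<subseteq> V"
  by (auto simp: nbhd_def)

lemma nbhd_sym: "u \<in> V \<Longrightarrow> v \<in> W \<Longrightarrow> u \<in> nbhd col b V v \<longleftrightarrow> v \<in> nbhd col b W u"
  by (auto simp: nbhd_def insert_commute)

lemma finite_nbhd: "finite V \<Longrightarrow> finite (nbhd col b V v)"
  using nbhd_subset finite_subset by metis

lemma card_nbhd_split: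
  assumes "finite V"
  shows "card (nbhd col b V v) + card (nbhd col (\<not> b) V v) = card (V - {v})"
proof -
  have "V - {v} = nbhd col b V v \<union> nbhd col (\<not> b) V v"
    and "nbhd col b V v \<inter> nbhd col (\<not> b) V v = {}"
    by (auto simp: nbhd_def)
  then show ?thesis
    using assms by (simp add: card_Un_disjoint finite_nbhd)
qed

lemma mono_clique_subset: "mono_clique col b S \<Longrightarrow> T \<subseteq> S \<Longrightarrow> mono_clique col b T"
  by (auto simp: mono_clique_def)

lemma mono_clique_insert:
  assumes "mono_clique col b S" "S \<subseteq> nbhd col b V v"
  shows "mono_clique col b (insert v S)"
  unfolding mono_clique_def
proof (intro ballI impI)
  fix x y assume "x \<in> insert v S" "y \<in> insert v S" "x \<noteq> y"
  then consider "x \<in> S" "y \<in> S" | "x = v" "y \<in> S" | "x \<in> S" "y = v" by auto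
  then show "col {x, y} = b"
  proof cases
    case 1
    with assms(1) \<open>x \<noteq> y\<close> show ?thesis by (simp add: mono_clique_def)
  next
    case 2
    with assms(2) show ?thesis by (auto simp: nbhd_def)
  next
    case 3
    with assms(2) show ?thesis by (auto simp: nbhd_def insert_commute)
  qed
qed

lemma mono_clique_Un:
  assumes "mono_clique col b S" "mono_clique col b T"
    and "\<And>u v. u \<in> S \<Longrightarrow> v \<in> T \<Longrightarrow> col {u, v} = b"
  shows "mono_clique col b (S \<union> T)"
  unfolding mono_clique_def
proof (intro ballI impI)
  fix x y assume "x \<in> S \<union> T" "y \<in> S \<union> T" "x \<noteq> y"
  then consider "x \<in> S" "y \<in> S" | "x \<in> T" "y \<in> T" | "x \<in> S" "y \<in> T" | "x \<in> T" "y \<in> S"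
    by auto
  then show "col {x, y} = b"
  proof cases
    case 4
    then show ?thesis using assms(3)[of y x] by (simp add: insert_commute)
  qed (use assms \<open>x \<noteq> y\<close> in \<open>simp_all add: mono_clique_def\<close>)
qed

lemma card_insert_nbhd:
  assumes "finite V" "S \<subseteq> nbhd col b V v"
  shows "card (insert v S) = Suc (card S)"
proof -
  have "finite S"
    using assms finite_nbhd finite_subset by metis
  moreover have "v \<notin> S"
    using assms by (auto simp: nbhd_def)
  ultimately show ?thesis by simp
qed

text \<open>Both sides count the ordered pairs from \<open>A\<close> and \<open>W\<close> joined in
  colour \<open>b\<close>; the two sets may overlap.\<close>

lemma nbhd_double_count:
  assumes "finite A" "finite W"
  shows "(\<Sum>w\<in>W. card (nbhd col b A w)) = (\<Sum>a\<in>A. card (nbhd col b W a))"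
proof -
  have *: "card (nbhd col b X y) = (\<Sum>x\<in>X. if x \<in> nbhd col b X y then 1 else 0)" if "finite X" for X y
  proof -
    have "X \<inter> {x. x \<in> nbhd col b X y} = nbhd col b X y"
      using nbhd_subset[of col b X y] by blast
    with that show ?thesis
      by (simp add: sum.If_cases)
  qed
  have "(\<Sum>w\<in>W. card (nbhd col b A w)) = (\<Sum>w\<in>W. \<Sum>a\<in>A. if a \<in> nbhd col b A w then 1 else 0)"
    by (simp only: *[OF assms(1)])
  also have "\<dots> = (\<Sum>a\<in>A. \<Sum>w\<in>W. if a \<in> nbhd col b A w then 1 else 0)"
    by (rule sum.swap)
  also have "\<dots> = (\<Sum>a\<in>A. \<Sum>w\<in>W. if w \<in> nbhd col b W a then 1 else 0)"
    by (intro sum.cong refl if_cong nbhd_sym)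
  also have "\<dots> = (\<Sum>a\<in>A. card (nbhd col b W a))"
    by (simp only: *[OF assms(2)])
  finally show ?thesis .
qed

text \<open>The weights satisfy $1/(z+1) + 1/(1+1/z) = 1$; a large $z$ is efficient for $a$ much smaller than $b$.\<close>

lemma erdos_szekeres:
  fixes z :: real
  assumes "z > 0" "finite S" "real (card S) + 1 > (z + 1) ^ a * (1 + 1 / z) ^ b"
  shows "(\<exists>A\<subseteq>S. card A = a \<and> mono_clique col c A) \<or>
         (\<exists>B\<subseteq>S. card B = b \<and> mono_clique col (\<not> c) B)"
  using assms(2,3)
proof (induction "a + b" arbitrary: a b S)
  case 0
  then show ?case by (auto simp: mono_clique_def intro!: exI[of _ "{}"])
next
  case (Suc d)
  show ?case
  proof (cases "a = 0 \<or> b = 0")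
    case True
    then show ?thesis by (auto simp: mono_clique_def intro!: exI[of _ "{}"])
  next
    case False
    then obtain a' b' where a: "a = Suc a'" and b: "b = Suc b'"
      by (meson not0_implies_Suc)
    define X where "X = (z + 1) ^ a' * (1 + 1 / z) ^ b'"
    have "1 * 1 \<le> X"
      unfolding X_def using \<open>z > 0\<close> by (intro mult_mono one_le_power) auto
    \<comment> \<open>Since \<open>(z + 1) * (1 + 1 / z) = (z + 1) + (1 + 1 / z)\<close>, the
      threshold is the sum of those for the two subproblems \<open>a'\<close>, \<open>b\<close> and
      \<open>a\<close>, \<open>b'\<close>.\<close>
    moreover have tot: "(z + 1) ^ a * (1 + 1 / z) ^ b = (1 + 1 / z) * X + (z + 1) * X"
      using \<open>z > 0\<close> by (simp add: a b X_def field_simps)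
    moreover have "(1 + 1 / z) * X \<ge> 1 * 1" "(z + 1) * X \<ge> 1 * 1"
      using \<open>1 * 1 \<le> X\<close> \<open>z > 0\<close> by (intro mult_mono; simp)+
    ultimately have pos: "real (card S) > 0"
      using Suc.prems(2) by linarith
    then obtain v where v: "v \<in> S" by fastforce
    have ins: "\<exists>A\<subseteq>S. card A = Suc m \<and> mono_clique col i A"
      if "A \<subseteq> nbhd col i S v" "card A = m" "mono_clique col i A" for A i m
      using that v mono_clique_insert[of col i A S v] card_insert_nbhd[OF Suc.prems(1), of A col i v]
        nbhd_subset[of col i S v]
      by (intro exI[of _ "insert v A"]) auto
    have nb: "A \<subseteq> S" if "A \<subseteq> nbhd col i S v" for A i
      using that nbhd_subset by fast
    have fin: "finite (nbhd col i S v)" for i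
      using Suc.prems(1) by (rule finite_nbhd)
    have "card (nbhd col c S v) + card (nbhd col (\<not> c) S v) + 1 = card S"
      using card_nbhd_split[OF Suc.prems(1), of col c v] v Suc.prems(1) pos
      by simp
    then have "real (card (nbhd col c S v)) + real (card (nbhd col (\<not> c) S v)) + 1 = real (card S)"
      by linarith
    \<comment> \<open>The \<open>+ 1\<close> accounts for \<open>v\<close>:
      \<open>card S + 1\<close> is the sum of the two degrees, each increased by one, so one of
      these exceeds its share.\<close>
    then consider "real (card (nbhd col c S v)) + 1 > (1 + 1 / z) * X"
      | "real (card (nbhd col (\<not> c) S v)) + 1 > (z + 1) * X"
      using Suc.prems(2) tot by linarith
    then show ?thesis
    proof cases
      case 1
      then have "real (card (nbhd col c S v)) + 1 > (z + 1) ^ a' * (1 + 1 / z) ^ b"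
        by (simp add: X_def b mult_ac)
      from Suc.hyps(1)[OF _ fin this] Suc.hyps(2) a show ?thesis
        using ins nb by (metis add_Suc diff_Suc_1)
    next
      case 2
      then have "real (card (nbhd col (\<not> c) S v)) + 1 > (z + 1) ^ a * (1 + 1 / z) ^ b'"
        by (simp add: X_def a mult_ac)
      from Suc.hyps(1)[OF _ fin this] Suc.hyps(2) b show ?thesis
        using ins nb by (metis add_Suc_right diff_Suc_1)
    qed
  qed
qed

text \<open>Weight each \<open>P\<close> by \<open>(1 / z) ^ card P\<close>: all subsets together
  weigh \<open>(1 + 1 / z) ^ card A\<close>, and one with at most \<open>m\<close> elements weighs
  at least \<open>(1 / z) ^ m\<close>. Weakening \<open>z ^ m\<close> to \<open>(z + 1) ^ m\<close>
  lets the bound combine with that of \<open>erdos_szekeres\<close>.\<close>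

lemma card_subsets_le:
  fixes z :: real
  assumes "finite A" "z \<ge> 1"
  shows "real (card {P. P \<subseteq> A \<and> card P \<le> m}) \<le> (z + 1) ^ m * (1 + 1 / z) ^ card A"
proof -
  have gen: "(\<Sum>P\<in>Pow A. (1 / z) ^ card P) = (1 + 1 / z) ^ card A"
    using assms(1)
  proof induction
    case (insert x A)
    have "(\<Sum>P\<in>Pow (insert x A). (1 / z) ^ card P)
        = (\<Sum>P\<in>Pow A. (1 / z) ^ card P) + (\<Sum>P\<in>insert x ` Pow A. (1 / z) ^ card P)"
      using insert.hyps by (subst Pow_insert, subst sum.union_disjoint) auto
    also have "(\<Sum>P\<in>insert x ` Pow A. (1 / z) ^ card P) = (\<Sum>P\<in>Pow A. (1 / z) ^ card (insert x P))"
      using insert.hyps by (subst sum.reindex) (auto simp: inj_on_def)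
    also have "\<dots> = (\<Sum>P\<in>Pow A. 1 / z * (1 / z) ^ card P)"
    proof (intro sum.cong refl)
      fix P assume "P \<in> Pow A"
      then have "finite P" "x \<notin> P" using insert.hyps finite_subset by auto
      then show "(1 / z) ^ card (insert x P) = 1 / z * (1 / z) ^ card P" by simp
    qed
    finally show ?case
      using insert.IH insert.hyps by (simp add: algebra_simps flip: sum_divide_distrib)
  qed simp
  have "real (card {P. P \<subseteq> A \<and> card P \<le> m}) * (1 / z) ^ m = (\<Sum>P\<in>{P. P \<subseteq> A \<and> card P \<le> m}. (1 / z) ^ m)"
    by simp
  also have "\<dots> \<le> (\<Sum>P\<in>{P. P \<subseteq> A \<and> card P \<le> m}. (1 / z) ^ card P)"
    using assms by (intro sum_mono power_decreasing) auto
  also have "\<dots> \<le> (\<Sum>P\<in>Pow A. (1 / z) ^ card P)"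
    using assms by (intro sum_mono2) auto
  finally have "real (card {P. P \<subseteq> A \<and> card P \<le> m}) * (1 / z) ^ m \<le> (1 + 1 / z) ^ card A"
    using gen by simp
  then have "real (card {P. P \<subseteq> A \<and> card P \<le> m}) \<le> z ^ m * (1 + 1 / z) ^ card A"
    using assms by (simp add: field_simps power_one_over)
  also have "\<dots> \<le> (z + 1) ^ m * (1 + 1 / z) ^ card A"
    using assms by (intro mult_right_mono power_mono) auto
  finally show ?thesis .
qed

subsection \<open>Colourings in which one colour is sparse\<close>

text \<open>
  A maximum clique $A$ of the dense colour is enlarged: most vertices miss only few elements of $A$, so
  by pigeonhole a large class of them misses the same subset $P$; a small clique $B$ inside the class
  has more elements than $P$, and $(A - P) \<union> B$ is a clique.
\<close>

lemma sparse_colour_bound: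
  fixes z :: real
  assumes fin: "finite V"
    and deg: "\<And>v. v \<in> V \<Longrightarrow> card (nbhd col (\<not> c) V v) \<le> D"
    and D: "2 * q * D \<le> card V" and "q \<ge> 1" and "z \<ge> 1"
    and no: "\<And>S b. S \<subseteq> V \<Longrightarrow> mono_clique col b S \<Longrightarrow> card S \<noteq> n"
  shows "real (card V) \<le> 2 * ((z + 1) ^ (2 * (n div q) + 1) * (1 + 1 / z) ^ (2 * n)) + 2 * real n"
proof -
  define m where "m = n div q"
  have small: "card S < n" if "S \<subseteq> V" "mono_clique col b S" for S b
  proof (rule ccontr)
    assume "\<not> card S < n"
    then obtain T where "T \<subseteq> S" "card T = n"
      by (metis not_less obtain_subset_with_card_n)
    with no that show False using mono_clique_subset by (metis subset_trans)
  qed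
  define \<C> where "\<C> = {A. A \<subseteq> V \<and> mono_clique col c A}"
  have "{} \<in> \<C>" by (simp add: \<C>_def mono_clique_def)
  moreover have "\<forall>B. B \<in> \<C> \<longrightarrow> card B < n"
    using small unfolding \<C>_def by blast
  ultimately obtain A where "A \<in> \<C>" and max: "\<And>B. B \<in> \<C> \<Longrightarrow> card B \<le> card A"
    using ex_has_greatest_nat[of "\<lambda>A. A \<in> \<C>" "{}" card n] by blast
  then have A: "A \<subseteq> V" "mono_clique col c A" by (auto simp: \<C>_def)
  have finA: "finite A" using A(1) fin finite_subset by blast
  have tn: "card A < n" using small A by blast
  let ?p = "\<lambda>w. nbhd col (\<not> c) A w"
  define Bad where "Bad = {w \<in> V. card (?p w) > m}"
  define W where "W = {w \<in> V - A. card (?p w) \<le> m}"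
  have "finite Bad" "finite W" using fin by (auto simp: Bad_def W_def)
  \<comment> \<open>Count the pairs of colour \<open>\<not> c\<close> between \<open>A\<close> and
    \<open>V\<close>: a bad vertex is in at least \<open>m + 1\<close> of them, an element of
    \<open>A\<close> in at most \<open>D\<close>. The rounding in \<open>m = n div q\<close> still
    leaves \<open>q * (m + 1) > n > card A\<close>.\<close>
  have "2 * card Bad \<le> card V"
  proof -
    have "(m + 1) * card Bad = (\<Sum>w\<in>Bad. m + 1)" by simp
    also have "\<dots> \<le> (\<Sum>w\<in>Bad. card (?p w))" by (intro sum_mono) (auto simp: Bad_def)
    also have "\<dots> \<le> (\<Sum>w\<in>V. card (?p w))" using fin by (intro sum_mono2) (auto simp: Bad_def)
    also have "\<dots> = (\<Sum>a\<in>A. card (nbhd col (\<not> c) V a))" using finA fin by (rule nbhd_double_count)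
    also have "\<dots> \<le> (\<Sum>a\<in>A. D)" using deg A(1) by (intro sum_mono) auto
    finally have *: "(m + 1) * card Bad \<le> card A * D" by simp
    have "q * (m + 1) > n"
      using \<open>q \<ge> 1\<close> unfolding m_def by (metis Suc_eq_plus1 dividend_less_times_div less_le_trans mult_Suc_right not_one_le_zero neq0_conv order_refl add.commute)
    then have "card A * card V \<le> q * (m + 1) * card V" using tn by simp
    moreover have "q * (m + 1) * (2 * card Bad) \<le> card A * card V"
    proof -
      have "q * (m + 1) * (2 * card Bad) = 2 * q * ((m + 1) * card Bad)" by (simp add: algebra_simps)
      also have "\<dots> \<le> 2 * q * (card A * D)" using * by (intro mult_left_mono) auto
      also have "\<dots> = card A * (2 * q * D)" by (simp add: algebra_simps)
      also have "\<dots> \<le> card A * card V" using D by (intro mult_left_mono) auto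
      finally show ?thesis .
    qed
    ultimately have "q * (m + 1) * (2 * card Bad) \<le> q * (m + 1) * card V" by linarith
    then show ?thesis using \<open>q * (m + 1) > n\<close> by (metis mult_le_cancel1 gr_implies_not0 neq0_conv)
  qed
  moreover have "card V \<le> card Bad + card W + card A"
  proof -
    have "V \<subseteq> (Bad \<union> W) \<union> A" by (auto simp: Bad_def W_def)
    then have "card V \<le> card ((Bad \<union> W) \<union> A)"
      using finA \<open>finite Bad\<close> \<open>finite W\<close> by (intro card_mono) auto
    also have "\<dots> \<le> card Bad + card W + card A"
      using card_Un_le[of "Bad \<union> W" A] card_Un_le[of Bad W] by linarith
    finally show ?thesis .
  qed
  ultimately have V_le: "card V \<le> 2 * card W + 2 * n"
    using tn by linarith
  \<comment> \<open>The threshold that forces a class to contain a clique of size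
    \<open>m + 1\<close> in colour \<open>c\<close>, or one of size \<open>n\<close> in the other
    colour. The latter is forbidden; the former is larger than any missed set
    \<open>P\<close>.\<close>
  define L where "L = (z + 1) ^ (m + 1) * (1 + 1 / z) ^ n"
  have cls: "real (card {w \<in> W. ?p w = P}) \<le> L" for P
  proof (cases "\<exists>w\<in>W. ?p w = P")
    case False
    then have "{w \<in> W. ?p w = P} = {}" by auto
    then have "card {w \<in> W. ?p w = P} = 0" by (simp only: card.empty)
    then show ?thesis using \<open>z \<ge> 1\<close> by (simp only:) (simp add: L_def)
  next
    case True
    let ?W = "{w \<in> W. ?p w = P}"
    have P: "P \<subseteq> A" "card P \<le> m" using True by (auto simp: W_def nbhd_def)
    show ?thesis
    proof (rule ccontr)
      assume "\<not> ?thesis"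
      then have *: "real (card ?W) + 1 > (z + 1) ^ (m + 1) * (1 + 1 / z) ^ n"
        by (simp add: L_def)
      have "?W \<subseteq> V - A" by (auto simp: W_def)
      have "z > 0" "finite ?W" using \<open>z \<ge> 1\<close> \<open>finite W\<close> by auto
      from erdos_szekeres[OF this *, of col c] show False
      proof
        assume "\<exists>B\<subseteq>?W. card B = m + 1 \<and> mono_clique col c B"
        then obtain B where B: "B \<subseteq> ?W" "card B = m + 1" "mono_clique col c B" by blast
        have "mono_clique col c ((A - P) \<union> B)"
        proof (rule mono_clique_Un)
          show "mono_clique col c (A - P)" using A(2) mono_clique_subset by (metis Diff_subset)
          fix u v assume "u \<in> A - P" "v \<in> B"
          moreover from this have "u \<noteq> v" "?p v = P" using B(1) \<open>?W \<subseteq> V - A\<close> by auto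
          ultimately have "u \<notin> ?p v" "u \<in> A" "u \<noteq> v" by auto
          then show "col {u, v} = c" by (auto simp: nbhd_def insert_commute)
        qed (fact B(3))
        then have "card ((A - P) \<union> B) \<le> card A"
          using A(1) B(1) \<open>?W \<subseteq> V - A\<close> by (intro max) (auto simp: \<C>_def)
        moreover have "card ((A - P) \<union> B) = card (A - P) + card B"
          using finA B(1) \<open>?W \<subseteq> V - A\<close> \<open>finite ?W\<close> finite_subset
          by (intro card_Un_disjoint) blast+
        moreover have "card (A - P) = card A - card P"
          using P finA finite_subset by (intro card_Diff_subset) auto
        ultimately show False using B(2) P(2) by linarith
      next
        assume "\<exists>B\<subseteq>?W. card B = n \<and> mono_clique col (\<not> c) B"
        with no \<open>?W \<subseteq> V - A\<close> show False by (metis (no_types, lifting) Diff_subset subset_trans)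
      qed
    qed
  qed
  \<comment> \<open>The index set of the classes. The bound on its size, multiplied by
    \<open>L\<close>, produces the exponents \<open>2 * m + 1\<close> and
    \<open>2 * n\<close>.\<close>
  let ?P = "{P. P \<subseteq> A \<and> card P \<le> m}"
  have "finite ?P" using finA by auto
  have "card W \<le> card (\<Union>P\<in>?P. {w \<in> W. ?p w = P})"
  proof (intro card_mono)
    show "finite (\<Union>P\<in>?P. {w \<in> W. ?p w = P})"
      by (rule finite_subset[OF _ \<open>finite W\<close>]) blast
    show "W \<subseteq> (\<Union>P\<in>?P. {w \<in> W. ?p w = P})"
      using nbhd_subset[of col "\<not> c" A] by (auto simp: W_def)
  qed
  also have "\<dots> \<le> (\<Sum>P\<in>?P. card {w \<in> W. ?p w = P})"
    by (rule card_UN_le[OF \<open>finite ?P\<close>])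
  finally have "real (card W) \<le> (\<Sum>P\<in>?P. real (card {w \<in> W. ?p w = P}))"
    by (simp only: of_nat_le_iff flip: of_nat_sum)
  also have "\<dots> \<le> (\<Sum>P\<in>?P. L)" by (intro sum_mono cls)
  also have "\<dots> = real (card ?P) * L" by simp
  also have "\<dots> \<le> ((z + 1) ^ m * (1 + 1 / z) ^ card A) * L"
    using \<open>z \<ge> 1\<close> finA by (intro mult_right_mono card_subsets_le) (auto simp: L_def)
  also have "\<dots> \<le> ((z + 1) ^ m * (1 + 1 / z) ^ n) * L"
    using \<open>z \<ge> 1\<close> tn by (intro mult_right_mono mult_left_mono power_increasing) (auto simp: L_def)
  also have "\<dots> = (z + 1) ^ (2 * m + 1) * (1 + 1 / z) ^ (2 * n)"
    by (simp add: L_def mult_2 power_add)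
  finally show ?thesis using V_le unfolding m_def by linarith
qed

section \<open>Exponential lower bound for clique Ramsey numbers\<close>

text \<open>Erdos's union bound in counting form: a colouring is identified with its set
  \<open>X\<close> of \<open>True\<close> edges, and the hypothesis keeps the sets
  \<open>bad S\<close> from covering all of \<open>Pow (E T)\<close>.\<close>

lemma erdos_lower_bound:
  assumes "2 * (N choose n) < 2 ^ (n choose 2)"
  obtains col where "\<And>S b. S \<subseteq> {..<N} \<Longrightarrow> mono_clique col b S \<Longrightarrow> card S \<noteq> n"
proof -
  define E where "E = (\<lambda>S::nat set. {e. e \<subseteq> S \<and> card e = 2})"
  define T where "T = {..<N}"
  define \<S> where "\<S> = {S. S \<subseteq> T \<and> card S = n}"
  have finE: "finite (E S)" "card (E S) = card S choose 2" if "finite S" for S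
    using that n_subsets[of S 2] by (auto simp: E_def)
  have E_mono: "E S \<subseteq> E T" if "S \<subseteq> T" for S T using that by (auto simp: E_def)
  have "finite T" "finite \<S>" "card \<S> = N choose n"
    using n_subsets[of T n] by (auto simp: T_def \<S>_def)
  \<comment> \<open>\<open>S\<close> is monochromatic for \<open>X\<close> when \<open>X\<close>
    contains \<open>E S\<close> (colour \<open>True\<close>) or avoids it (colour
    \<open>False\<close>).\<close>
  define bad where "bad = (\<lambda>S. (\<lambda>X. E S \<union> X) ` Pow (E T - E S) \<union> Pow (E T - E S))"
  have "2 ^ (n choose 2) * card (bad S) \<le> 2 * 2 ^ card (E T)" if "S \<in> \<S>" for S
  proof -
    have S: "finite S" "S \<subseteq> T" "card S = n" using that \<open>finite T\<close> finite_subset by (auto simp: \<S>_def)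
    have "finite (E T)" using finE \<open>finite T\<close> by auto
    have "card (bad S) \<le> card ((\<lambda>X. E S \<union> X) ` Pow (E T - E S)) + card (Pow (E T - E S))"
      unfolding bad_def by (rule card_Un_le)
    also have "\<dots> \<le> card (Pow (E T - E S)) + card (Pow (E T - E S))"
      using \<open>finite (E T)\<close> by (intro add_right_mono card_image_le) auto
    also have "\<dots> = 2 * 2 ^ (card (E T) - card (E S))"
      using \<open>finite (E T)\<close> S finE(1)[OF S(1)] E_mono[OF S(2)] by (simp add: card_Pow card_Diff_subset)
    finally have "2 ^ card (E S) * card (bad S) \<le> 2 ^ card (E S) * (2 * 2 ^ (card (E T) - card (E S)))"
      by (intro mult_left_mono) auto
    also have "\<dots> = 2 * 2 ^ card (E T)"
      using card_mono[OF \<open>finite (E T)\<close> E_mono[OF S(2)]] by (simp add: flip: power_add)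
    finally show ?thesis using finE(2)[OF S(1)] S(3) by simp
  qed
  note bad = this
  have "2 ^ (n choose 2) * card (\<Union>S\<in>\<S>. bad S) \<le> 2 ^ (n choose 2) * (\<Sum>S\<in>\<S>. card (bad S))"
    using card_UN_le[OF \<open>finite \<S>\<close>] by (intro mult_left_mono) auto
  also have "\<dots> \<le> (\<Sum>S\<in>\<S>. 2 * 2 ^ card (E T))"
    unfolding sum_distrib_left by (intro sum_mono bad)
  also have "\<dots> = 2 * (N choose n) * 2 ^ card (E T)"
    using \<open>card \<S> = _\<close> by simp
  also have "\<dots> < 2 ^ (n choose 2) * 2 ^ card (E T)"
    using assms by (intro mult_strict_right_mono) auto
  finally have "card (\<Union>S\<in>\<S>. bad S) < card (Pow (E T))"
    using finE(1)[OF \<open>finite T\<close>] by (simp add: card_Pow)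
  moreover have "finite (\<Union>S\<in>\<S>. bad S)"
    using \<open>finite \<S>\<close> finE(1)[OF \<open>finite T\<close>] by (auto simp: bad_def)
  ultimately obtain X where X: "X \<subseteq> E T" "X \<notin> (\<Union>S\<in>\<S>. bad S)"
    by (meson PowD card_mono not_le subsetI)
  have "card S \<noteq> n" if S: "S \<subseteq> {..<N}" "mono_clique (\<lambda>e. e \<in> X) b S" for S b
  proof
    assume "card S = n"
    with S(1) have "S \<in> \<S>" by (simp add: \<S>_def T_def)
    with X have nb: "X \<notin> bad S" by blast
    have *: "(e \<in> X) = b" if "e \<in> E S" for e
      using that S(2) unfolding E_def mono_clique_def by (auto simp: card_2_iff)
    show False
    proof (cases b)
      case True
      then have "X = E S \<union> (X - E S)" "X - E S \<in> Pow (E T - E S)" using * X(1) by auto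
      with nb show False unfolding bad_def by blast
    next
      case False
      then have "X \<in> Pow (E T - E S)" using * X(1) by auto
      with nb show False unfolding bad_def by blast
    qed
  qed
  then show ?thesis using that by blast
qed

text \<open>On \<open>2 ^ k\<close> vertices the counting condition follows from
  \<open>k * n + 1 < n choose 2\<close>. As \<open>2 * k + 2 \<le> n\<close>, the binomial exceeds
  \<open>k * n\<close> by at least \<open>n / 2\<close>, which is more than 1 for
  \<open>n \<ge> 3\<close>.\<close>

lemma erdos_lower_bound_pow2:
  assumes "n \<ge> 3"
  obtains col where "\<And>S b. S \<subseteq> {..<(2::nat) ^ ((n - 2) div 2)} \<Longrightarrow> mono_clique col b S \<Longrightarrow> card S \<noteq> n"
proof -
  define k where "k = (n - 2) div 2"
  have "(2 ^ k choose n) \<le> (2 ^ k) ^ n"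
  proof (cases "n \<le> 2 ^ k")
    case True
    then show ?thesis by (rule binomial_le_pow)
  next
    case False
    then show ?thesis by (subst binomial_eq_0) linarith+
  qed
  then have le: "2 * (2 ^ k choose n) \<le> (2::nat) ^ (k * n + 1)"
    by (simp only: power_mult power_add power_one_right)
  have "k * n + 1 < n choose 2"
  proof -
    have "2 * k + 2 \<le> n" using assms unfolding k_def by linarith
    then have "(2 * k + 2) * n \<le> n * n" by (rule mult_right_mono) simp
    moreover have "2 * (n choose 2) = n * n - n"
      by (simp add: choose_two diff_mult_distrib2)
    ultimately show ?thesis using assms by (simp add: algebra_simps)
  qed
  then have "(2::nat) ^ (k * n + 1) < 2 ^ (n choose 2)" by (rule power_strict_increasing) simp
  with le have "2 * (2 ^ k choose n) < 2 ^ (n choose 2)" by (rule le_less_trans)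
  then obtain col where "\<And>S b. S \<subseteq> {..<(2::nat) ^ k} \<Longrightarrow> mono_clique col b S \<Longrightarrow> card S \<noteq> n"
    by (rule erdos_lower_bound) blast
  from that[OF this[unfolded k_def]] show ?thesis .
qed

subsection \<open>Growth of the clique Ramsey numbers\<close>

lemma complete_graph_edges_iff:
  "e \<in> complete_graph_edges n \<longleftrightarrow> (\<exists>i j. i < n \<and> j < n \<and> i \<noteq> j \<and> e = {i, j})"
  by (auto simp: complete_graph_edges_def card_2_iff)

lemma graph_on_complete: "graph_on {..<n} (complete_graph_edges n)"
  by (auto simp: graph_on_def complete_graph_edges_def)

text \<open>Passes from embeddings to vertex sets, the language of the clique lemmas above.\<close>

lemma mono_copy_complete_iff:
  "mono_copy {..<n} (complete_graph_edges n) N col \<longleftrightarrow>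
    (\<exists>S\<subseteq>{..<N}. card S = n \<and> (\<exists>b. mono_clique col b S))"
proof
  assume "mono_copy {..<n} (complete_graph_edges n) N col"
  then obtain \<phi> b where \<phi>: "inj_on \<phi> {..<n}" "\<phi> ` {..<n} \<subseteq> {..<N}"
    and b: "\<forall>e\<in>complete_graph_edges n. col (\<phi> ` e) = b"
    unfolding mono_copy_def by (elim exE conjE) rule
  have "mono_clique col b (\<phi> ` {..<n})"
    unfolding mono_clique_def
  proof (intro ballI impI)
    fix u v assume "u \<in> \<phi> ` {..<n}" "v \<in> \<phi> ` {..<n}" "u \<noteq> v"
    then obtain i j where ij: "i < n" "j < n" "i \<noteq> j" "u = \<phi> i" "v = \<phi> j" by auto
    then have "{i, j} \<in> complete_graph_edges n" unfolding complete_graph_edges_iff by blast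
    from b[rule_format, OF this] show "col {u, v} = b" using ij by simp
  qed
  moreover have "card (\<phi> ` {..<n}) = n" using \<phi>(1) by (simp add: card_image)
  ultimately show "\<exists>S\<subseteq>{..<N}. card S = n \<and> (\<exists>b. mono_clique col b S)" using \<phi>(2) by blast
next
  assume "\<exists>S\<subseteq>{..<N}. card S = n \<and> (\<exists>b. mono_clique col b S)"
  then obtain S b where S: "S \<subseteq> {..<N}" "card S = n" "mono_clique col b S" by blast
  then have "finite S" using finite_subset by blast
  then obtain \<phi> where "bij_betw \<phi> {0..<card S} S"
    using ex_bij_betw_nat_finite by blast
  then have \<phi>: "bij_betw \<phi> {..<n} S" using S(2) by (simp add: atLeast0LessThan)
  have "col (\<phi> ` e) = b" if e: "e \<in> complete_graph_edges n" for e
  proof -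
    obtain i j where ij: "i < n" "j < n" "i \<noteq> j" "e = {i, j}"
      using e unfolding complete_graph_edges_iff by blast
    then have "\<phi> i \<in> S" "\<phi> j \<in> S" "\<phi> i \<noteq> \<phi> j"
      using \<phi> by (auto simp: bij_betw_def inj_on_eq_iff)
    then show ?thesis using S(3) ij by (simp add: mono_clique_def)
  qed
  moreover have "inj_on \<phi> {..<n}" "\<phi> ` {..<n} \<subseteq> {..<N}"
    using \<phi> S(1) by (simp_all add: bij_betw_def)
  ultimately show "mono_copy {..<n} (complete_graph_edges n) N col"
    unfolding mono_copy_def by (intro exI[of _ \<phi>] exI[of _ b] conjI ballI)
qed

lemma mono_copy_subgraph:
  assumes "mono_copy V' E' N' col" "V \<subseteq> V'" "E \<subseteq> E'" "N' \<le> N"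
  shows "mono_copy V E N col"
proof -
  obtain \<phi> b where \<phi>: "inj_on \<phi> V'" "\<phi> ` V' \<subseteq> {..<N'}" "\<forall>e\<in>E'. col (\<phi> ` e) = b"
    using assms(1) unfolding mono_copy_def by (elim exE conjE) rule
  show ?thesis
    unfolding mono_copy_def
  proof (intro exI[of _ \<phi>] exI[of _ b] conjI)
    show "inj_on \<phi> V" using \<phi>(1) assms(2) by (rule inj_on_subset)
    show "\<phi> ` V \<subseteq> {..<N}" using \<phi>(2) assms(2,4) by fastforce
    show "\<forall>e\<in>E. col (\<phi> ` e) = b" using \<phi>(3) assms(3) by (simp add: subset_iff)
  qed
qed

abbreviation (input) clique_ramsey :: "nat \<Rightarrow> nat" where
  "clique_ramsey n \<equiv> ramsey_number {..<n} (complete_graph_edges n)"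

lemma ramsey_number_le: "(\<And>col. mono_copy V E N col) \<Longrightarrow> ramsey_number V E \<le> N"
  unfolding ramsey_number_def by (rule Least_le) blast

text \<open>Erdos-Szekeres with \<open>z = 1\<close> gives the classical bound \<open>4 ^ n\<close>.
  Existence matters because \<open>ramsey_number\<close> is a \<open>LEAST\<close>.\<close>

lemma mono_copy_complete_exists:
  fixes n :: nat
  shows "\<exists>N. \<forall>col. mono_copy {..<n} (complete_graph_edges n) N col"
proof (intro exI allI)
  fix col
  have "(1 + 1) ^ n * (1 + 1 / 1) ^ n < real (card {..<(4::nat) ^ n}) + 1"
    by (simp flip: power_mult_distrib)
  then show "mono_copy {..<n} (complete_graph_edges n) (4 ^ n) col"
    unfolding mono_copy_complete_iff
    using erdos_szekeres[of 1 "{..<4 ^ n}" n n col True] by auto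
qed

text \<open>The \<open>LEAST\<close> is attained because \<open>E\<close> lies in the complete
  graph, and the property persists for larger \<open>N\<close>. Every use of a Ramsey number as a
  guarantee rests on this.\<close>

lemma mono_copy_ramsey:
  fixes n :: nat
  assumes "graph_on {..<n} E" "ramsey_number {..<n} E \<le> N"
  shows "mono_copy {..<n} E N col"
proof -
  have "E \<subseteq> complete_graph_edges n"
    using assms(1) by (auto simp: graph_on_def complete_graph_edges_def)
  then have "\<exists>N. \<forall>col. mono_copy {..<n} E N col"
    using mono_copy_complete_exists[of n] mono_copy_subgraph[OF _ subset_refl _ order_refl] by blast
  then have "\<forall>col. mono_copy {..<n} E (ramsey_number {..<n} E) col"
    unfolding ramsey_number_def by (rule LeastI_ex)
  then show ?thesis using mono_copy_subgraph[OF _ subset_refl subset_refl assms(2)] by blast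
qed

lemma ramsey_number_subgraph:
  fixes n :: nat
  assumes "graph_on {..<n} E'" "V \<subseteq> {..<n}" "E \<subseteq> E'"
  shows "ramsey_number V E \<le> ramsey_number {..<n} E'"
  using mono_copy_subgraph[OF mono_copy_ramsey[OF assms(1) order_refl] assms(2,3) order_refl]
  by (rule ramsey_number_le)

lemma clique_ramsey_mono: "m \<le> n \<Longrightarrow> clique_ramsey m \<le> clique_ramsey n"
  by (intro ramsey_number_subgraph graph_on_complete) (auto simp: complete_graph_edges_def)

lemma ramsey_number_less:
  fixes n :: nat
  assumes "graph_on {..<n} E" "\<not> mono_copy {..<n} E N col"
  shows "N < ramsey_number {..<n} E"
  using mono_copy_ramsey[OF assms(1)] assms(2) not_less by blast

lemma ramsey_number_ge_card:
  fixes n :: nat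
  assumes "graph_on {..<n} E"
  shows "n \<le> ramsey_number {..<n} E"
proof -
  have "mono_copy {..<n} E (ramsey_number {..<n} E) (\<lambda>_. True)"
    using assms order_refl by (rule mono_copy_ramsey)
  then obtain \<phi> where "inj_on \<phi> {..<n}" "\<phi> ` {..<n} \<subseteq> {..<ramsey_number {..<n} E}"
    unfolding mono_copy_def by (elim exE conjE) rule
  then show ?thesis using card_inj_on_le[of \<phi> "{..<n}" "{..<ramsey_number {..<n} E}"] by simp
qed

text \<open>A bijection with an initial segment pulls the colouring back, so that the Ramsey
  property applies inside neighbourhoods and other finite sets.\<close>

lemma mono_clique_exists:
  assumes "finite V" "clique_ramsey n \<le> card V"
  shows "\<exists>S\<subseteq>V. card S = n \<and> (\<exists>b. mono_clique col b S)"
proof -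
  obtain h where "bij_betw h {0..<card V} V"
    using ex_bij_betw_nat_finite[OF assms(1)] by blast
  then have h: "inj_on h {..<card V}" "h ` {..<card V} = V"
    by (simp_all add: bij_betw_def atLeast0LessThan)
  obtain S b where S: "S \<subseteq> {..<card V}" "card S = n" "mono_clique (\<lambda>e. col (h ` e)) b S"
    using mono_copy_ramsey[OF graph_on_complete assms(2)] unfolding mono_copy_complete_iff by blast
  have "mono_clique col b (h ` S)"
    unfolding mono_clique_def
  proof (intro ballI impI)
    fix u v assume "u \<in> h ` S" "v \<in> h ` S" "u \<noteq> v"
    then obtain i j where ij: "i \<in> S" "j \<in> S" "i \<noteq> j" "u = h i" "v = h j" by auto
    then have "col (h ` {i, j}) = b" using S(3) unfolding mono_clique_def by blast
    then show "col {u, v} = b" using ij by simp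
  qed
  moreover have "card (h ` S) = n"
    using S(2) card_image[OF inj_on_subset[OF h(1) S(1)]] by simp
  moreover have "h ` S \<subseteq> V" using S(1) h(2) by auto
  ultimately show ?thesis by (intro exI[of _ "h ` S"] exI[of _ b] conjI)
qed

section \<open>Ratio of consecutive clique Ramsey numbers\<close>

text \<open>A vertex \<open>v0\<close> with majority colour \<open>c\<close> splits the other
  vertices into its large neighbourhood \<open>T\<close> in that colour and the rest
  \<open>B\<close>. Seen from \<open>B\<close>, nearly all pairs between \<open>B\<close> and
  \<open>T\<close> have colour \<open>c\<close>; seen from \<open>T\<close>, few do. Double counting
  forces \<open>B\<close> to be small, and every vertex behaves nearly like
  \<open>v0\<close>.\<close>

lemma clique_free_almost_mono:
  assumes "finite V" "n \<ge> 1" "8 * clique_ramsey n \<le> card V"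
    and no: "\<And>S b. S \<subseteq> V \<Longrightarrow> mono_clique col b S \<Longrightarrow> card S \<noteq> Suc n"
  shows "\<exists>c. \<forall>v\<in>V. card (nbhd col (\<not> c) V v) \<le> 4 * clique_ramsey n"
proof -
  define \<rho> where "\<rho> = clique_ramsey n"
  have "\<rho> \<ge> 1" using ramsey_number_ge_card[OF graph_on_complete, of n] assms(2) unfolding \<rho>_def by linarith
  have V: "8 * \<rho> \<le> card V" using assms(3) by (simp add: \<rho>_def)
  have fin: "finite (nbhd col b V v)" for b v using assms(1) by (rule finite_nbhd)
  \<comment> \<open>A clique of size \<open>n\<close> in the intersection would extend to size
    \<open>Suc n\<close>: by \<open>v\<close> if its colour is \<open>b\<close>, by \<open>u\<close>
    otherwise.\<close>
  have key: "card (nbhd col b V v \<inter> nbhd col (\<not> b) V u) < \<rho>" if "u \<in> V" "v \<in> V" for u v b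
  proof (rule ccontr)
    assume "\<not> ?thesis"
    then obtain S b' where S: "S \<subseteq> nbhd col b V v \<inter> nbhd col (\<not> b) V u" "card S = n" "mono_clique col b' S"
      using mono_clique_exists[of "nbhd col b V v \<inter> nbhd col (\<not> b) V u" n col] fin
      unfolding \<rho>_def by auto
    then have "S \<subseteq> V" using nbhd_subset by fast
    obtain w where "w \<in> V" "S \<subseteq> nbhd col b' V w"
    proof (cases "b' = b")
      case True
      with S(1) \<open>v \<in> V\<close> show ?thesis by (intro that[of v]) auto
    next
      case False
      then have "b' = (\<not> b)" by auto
      with S(1) \<open>u \<in> V\<close> show ?thesis by (intro that[of u]) auto
    qed
    then show False
      using no[of "insert w S" b'] mono_clique_insert[OF S(3)] card_insert_nbhd[OF assms(1)] S(2) \<open>S \<subseteq> V\<close>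
      by (metis insert_subset)
  qed
  have "V \<noteq> {}" using V \<open>\<rho> \<ge> 1\<close> by auto
  then obtain v0 where v0: "v0 \<in> V" by blast
  have "card (nbhd col True V v0) + card (nbhd col False V v0) = card V - 1"
    using card_nbhd_split[OF assms(1), of col True v0] v0 assms(1) by simp
  then have "2 * card (nbhd col True V v0) + 1 \<ge> card V \<or> 2 * card (nbhd col False V v0) + 1 \<ge> card V"
    by linarith
  then obtain c where c: "2 * card (nbhd col c V v0) + 1 \<ge> card V" by blast
  define T where "T = nbhd col c V v0"
  define B where "B = nbhd col (\<not> c) V v0"
  have "finite T" "finite B" using fin by (auto simp: T_def B_def)
  have "T \<subseteq> V" "B \<subseteq> V" unfolding T_def B_def by (rule nbhd_subset)+
  have T2: "2 * \<rho> \<le> card T" using c V \<open>\<rho> \<ge> 1\<close> unfolding T_def by linarith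
  have "card T \<le> card (nbhd col c T b) + \<rho>" if "b \<in> B" for b
  proof -
    have "b \<notin> T" using that by (auto simp: T_def B_def nbhd_def)
    then have "T \<subseteq> nbhd col c T b \<union> (T \<inter> nbhd col (\<not> c) V b)"
      using \<open>T \<subseteq> V\<close> by (auto simp: nbhd_def)
    then have "card T \<le> card (nbhd col c T b \<union> (T \<inter> nbhd col (\<not> c) V b))"
      using \<open>finite T\<close> by (intro card_mono) (auto intro: finite_nbhd)
    also have "\<dots> \<le> card (nbhd col c T b) + card (T \<inter> nbhd col (\<not> c) V b)"
      by (rule card_Un_le)
    finally show ?thesis
      using key[of b v0 c] that \<open>B \<subseteq> V\<close> v0 unfolding T_def by fastforce
  qed
  then have "(\<Sum>b\<in>B. card T) \<le> (\<Sum>b\<in>B. card (nbhd col c T b) + \<rho>)"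
    by (rule sum_mono)
  also have "\<dots> = (\<Sum>t\<in>T. card (nbhd col c B t)) + card B * \<rho>"
    using nbhd_double_count[OF \<open>finite T\<close> \<open>finite B\<close>] by (simp add: sum.distrib)
  also have "(\<Sum>t\<in>T. card (nbhd col c B t)) \<le> (\<Sum>t\<in>T. \<rho>)"
  proof (rule sum_mono)
    fix t assume "t \<in> T"
    have "nbhd col c B t \<subseteq> nbhd col c V t \<inter> nbhd col (\<not> c) V v0"
      by (auto simp: nbhd_def B_def)
    then have "card (nbhd col c B t) \<le> card (nbhd col c V t \<inter> nbhd col (\<not> c) V v0)"
      using fin by (intro card_mono) auto
    also have "\<dots> < \<rho>" using key v0 \<open>t \<in> T\<close> \<open>T \<subseteq> V\<close> by auto
    finally show "card (nbhd col c B t) \<le> \<rho>" by simp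
  qed
  finally have "card B * card T \<le> card T * \<rho> + card B * \<rho>" by simp
  \<comment> \<open>As \<open>T\<close> has at least \<open>2 * \<rho>\<close> elements, the term
    \<open>card B * \<rho>\<close> is absorbed by half of the left side.\<close>
  moreover have "2 * (card B * \<rho>) \<le> card B * card T"
    using mult_left_mono[OF T2, of "card B"] by simp
  ultimately have "card B * card T \<le> 2 * (card T * \<rho>)" by linarith
  then have "card T * card B \<le> card T * (2 * \<rho>)" by (simp only: ac_simps)
  then have B2: "card B \<le> 2 * \<rho>" using T2 \<open>\<rho> \<ge> 1\<close> by (subst (asm) mult_le_cancel1) auto
  have "card (nbhd col (\<not> c) V v) \<le> 4 * \<rho>" if "v \<in> V" for v
  proof -
    \<comment> \<open>Apart from \<open>v0\<close> and \<open>B\<close>, the neighbours of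
      \<open>v\<close> in the sparse colour lie in \<open>T\<close>, where \<open>key\<close> bounds
      their number.\<close>
    have "nbhd col (\<not> c) V v \<subseteq> insert v0 (B \<union> (nbhd col c V v0 \<inter> nbhd col (\<not> c) V v))"
      by (auto simp: B_def nbhd_def)
    then have "card (nbhd col (\<not> c) V v) \<le> card (insert v0 (B \<union> (nbhd col c V v0 \<inter> nbhd col (\<not> c) V v)))"
      using \<open>finite B\<close> fin by (intro card_mono) auto
    also have "\<dots> \<le> Suc (card (B \<union> (nbhd col c V v0 \<inter> nbhd col (\<not> c) V v)))"
      by (rule card_insert_le_m1) auto
    also have "\<dots> \<le> Suc (card B + card (nbhd col c V v0 \<inter> nbhd col (\<not> c) V v))"
      using card_Un_le by simp
    finally show ?thesis using key[OF that v0, of c] B2 \<open>\<rho> \<ge> 1\<close> by linarith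
  qed
  then show ?thesis unfolding \<rho>_def by blast
qed

text \<open>The values \<open>z = 31\<close> and \<open>q = 100\<close> are chosen so that
  \<open>31 + 1 = 2 ^ 5\<close> and \<open>(1 + 1 / 31) ^ 20 \<le> 2\<close>: the left side grows
  roughly like \<open>2 ^ (n / 5)\<close>, the right side like \<open>2 ^ (n / 2)\<close>.\<close>

lemma growth_numeric:
  fixes n :: nat
  assumes "n \<ge> 40"
  shows "2 * ((31 + 1) ^ (2 * (n div 100) + 1) * (1 + 1 / 31) ^ (2 * n)) + 2 * real n < 2 ^ ((n - 2) div 2)"
proof -
  \<comment> \<open>In terms of \<open>p\<close> the exponents to compare are
    \<open>4 * p + 9\<close> and at least \<open>10 * p - 1\<close>; \<open>p \<ge> 2\<close>
    suffices, whence \<open>n \<ge> 40\<close>.\<close>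
  define p where "p = n div 20"
  have p: "20 * p \<le> n" "n < 20 * p + 20" "p \<ge> 2"
    using assms unfolding p_def by linarith+
  have "5 * (n div 100) \<le> p" unfolding p_def by linarith
  have "(31 + 1) ^ (2 * (n div 100) + 1) = (2::real) ^ (10 * (n div 100) + 5)"
    by (simp add: power_add power_mult)
  also have "\<dots> \<le> 2 ^ (2 * p + 5)"
    using \<open>5 * (n div 100) \<le> p\<close> by (intro power_increasing) auto
  finally have 1: "(31 + 1) ^ (2 * (n div 100) + 1) \<le> (2::real) ^ (2 * p + 5)" .
  have "(1 + 1 / 31 :: real) ^ (2 * n) \<le> (1 + 1 / 31) ^ (20 * (2 * p + 2))"
    using p by (intro power_increasing) auto
  also have "\<dots> = ((1 + 1 / 31) ^ 20) ^ (2 * p + 2)" by (rule power_mult)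
  also have "\<dots> \<le> 2 ^ (2 * p + 2)"
    by (intro power_mono) (simp_all add: power_divide)
  finally have 2: "(1 + 1 / 31 :: real) ^ (2 * n) \<le> 2 ^ (2 * p + 2)" .
  have "2 * ((31 + 1) ^ (2 * (n div 100) + 1) * (1 + 1 / 31) ^ (2 * n)) \<le> 2 * (2 ^ (2 * p + 5) * (2::real) ^ (2 * p + 2))"
    using 1 2 by (intro mult_left_mono mult_mono) auto
  also have "\<dots> = 2 ^ (4 * p + 8)"
    by (simp flip: power_Suc power_add)
  finally have 3: "2 * ((31 + 1) ^ (2 * (n div 100) + 1) * (1 + 1 / 31) ^ (2 * n)) \<le> (2::real) ^ (4 * p + 8)" .
  have "real p + 1 \<le> 2 ^ p" using less_exp[of p] by (metis Suc_leI of_nat_Suc of_nat_le_iff of_nat_numeral of_nat_power add.commute)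
  also have "(2::real) ^ p \<le> 2 ^ (4 * p)" by (intro power_increasing) auto
  finally have "40 * real p + 40 \<le> 2 ^ (4 * p + 8)" by (simp add: power_add)
  moreover have "2 * real n \<le> 40 * real p + 40" using p by linarith
  moreover have "(2::real) ^ (4 * p + 9) = 2 ^ (4 * p + 8) + 2 ^ (4 * p + 8)"
    by (simp add: power_add)
  ultimately have "2 * ((31 + 1) ^ (2 * (n div 100) + 1) * (1 + 1 / 31) ^ (2 * n)) + 2 * real n \<le> (2::real) ^ (4 * p + 9)"
    using 3 by linarith
  also have "\<dots> < 2 ^ ((n - 2) div 2)"
    using p by (intro power_strict_increasing) auto
  finally show ?thesis .
qed

text \<open>The factor 800 is \<open>2 * q * 4\<close> with \<open>q = 100\<close>: the sparse
  colour has degrees at most \<open>4 * clique_ramsey n\<close>, and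
  \<open>sparse_colour_bound\<close> asks for \<open>2 * q\<close> times as many vertices. It then
  makes an extremal colouring smaller than \<open>erdos_lower_bound_pow2\<close> allows.\<close>

lemma clique_ramsey_growth_large:
  assumes "n \<ge> 40"
  shows "clique_ramsey (Suc n) \<le> 800 * clique_ramsey n"
proof (rule ccontr)
  assume "\<not> ?thesis"
  then have N: "800 * clique_ramsey n \<le> clique_ramsey (Suc n) - 1" "clique_ramsey (Suc n) - 1 < clique_ramsey (Suc n)"
    by linarith+
  define V where "V = {..<clique_ramsey (Suc n) - 1}"
  have "\<exists>col. \<not> mono_copy {..<Suc n} (complete_graph_edges (Suc n)) (clique_ramsey (Suc n) - 1) col"
    using ramsey_number_le N(2) by (metis not_less)
  then obtain col where no: "\<And>S b. S \<subseteq> V \<Longrightarrow> mono_clique col b S \<Longrightarrow> card S \<noteq> Suc n"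
    unfolding mono_copy_complete_iff V_def by blast
  have V: "finite V" "card V = clique_ramsey (Suc n) - 1" by (auto simp: V_def)
  obtain c where c: "\<And>v. v \<in> V \<Longrightarrow> card (nbhd col (\<not> c) V v) \<le> 4 * clique_ramsey n"
    using clique_free_almost_mono[OF V(1) _ _ no] N V assms by fastforce
  have "real (card V) \<le> 2 * ((31 + 1) ^ (2 * (Suc n div 100) + 1) * (1 + 1 / 31) ^ (2 * Suc n)) + 2 * real (Suc n)"
    using N V by (intro sparse_colour_bound[OF V(1) c _ _ _ no]) auto
  also have "\<dots> < 2 ^ ((Suc n - 2) div 2)"
    using assms by (intro growth_numeric) auto
  finally have "card V < 2 ^ ((Suc n - 2) div 2)"
    by (simp only: of_nat_less_numeral_power_cancel_iff)
  moreover have "2 ^ ((Suc n - 2) div 2) < clique_ramsey (Suc n)"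
  proof -
    have "Suc n \<ge> 3" using assms by simp
    then obtain col where "\<And>S b. S \<subseteq> {..<(2::nat) ^ ((Suc n - 2) div 2)} \<Longrightarrow> mono_clique col b S \<Longrightarrow> card S \<noteq> Suc n"
      by (rule erdos_lower_bound_pow2) blast
    then have "\<not> mono_copy {..<Suc n} (complete_graph_edges (Suc n)) (2 ^ ((Suc n - 2) div 2)) col"
      unfolding mono_copy_complete_iff by blast
    then show ?thesis by (rule ramsey_number_less[OF graph_on_complete])
  qed
  ultimately show False using V(2) by linarith
qed

text \<open>For the finitely many \<open>n < 40\<close> the summand \<open>clique_ramsey 40\<close>
  suffices, because \<open>clique_ramsey n \<ge> n \<ge> 1\<close>.\<close>

lemma clique_ramsey_growth:
  "\<exists>C. \<forall>n\<ge>1. clique_ramsey (Suc n) \<le> C * clique_ramsey n"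
proof (intro exI allI impI)
  fix n :: nat assume "n \<ge> 1"
  show "clique_ramsey (Suc n) \<le> (800 + clique_ramsey 40) * clique_ramsey n"
  proof (cases "n \<ge> 40")
    case True
    then show ?thesis using clique_ramsey_growth_large[of n] by (simp add: algebra_simps)
  next
    case False
    then have "clique_ramsey (Suc n) \<le> clique_ramsey 40 * 1" using clique_ramsey_mono[of "Suc n" 40] by simp
    also have "\<dots> \<le> (800 + clique_ramsey 40) * clique_ramsey n"
      using ramsey_number_ge_card[OF graph_on_complete, of n] \<open>n \<ge> 1\<close> by (intro mult_mono) auto
    finally show ?thesis .
  qed
qed

subsection \<open>Cliques with pendant edges\<close>

text \<open>For \<open>1 \<le> s \<le> n\<close> the root \<open>0\<close> is a clique vertex, and
  the vertices from \<open>s\<close> to \<open>n - 1\<close> are leaves attached to it.\<close>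

definition tailed_clique :: "nat \<Rightarrow> nat \<Rightarrow> nat set set" where
  "tailed_clique s n = {e \<in> complete_graph_edges n. e \<subseteq> {..<s} \<or> 0 \<in> e}"

lemma graph_on_tailed_clique: "graph_on {..<n} (tailed_clique s n)"
  by (auto simp: graph_on_def tailed_clique_def complete_graph_edges_def)

lemma tailed_clique_same: "tailed_clique n n = complete_graph_edges n"
  by (auto simp: tailed_clique_def complete_graph_edges_def)

lemma complete_subset_tailed_clique: "s \<le> n \<Longrightarrow> complete_graph_edges s \<subseteq> tailed_clique s n"
  by (auto simp: tailed_clique_def complete_graph_edges_def)

lemma root_edge: "0 < i \<Longrightarrow> i < n \<Longrightarrow> {0, i} \<in> tailed_clique s n"
  by (auto simp: tailed_clique_def complete_graph_edges_def card_2_iff)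

text \<open>Orders the endpoints so that a pendant edge has its root \<open>0\<close> first.\<close>

lemma tailed_clique_edgeE:
  assumes "e \<in> tailed_clique s n"
  obtains i j where "i < n" "j < n" "i \<noteq> j" "e = {i, j}" "i < s \<and> j < s \<or> i = 0"
proof -
  from assms have e: "e \<in> complete_graph_edges n" and or: "e \<subseteq> {..<s} \<or> 0 \<in> e"
    by (simp_all add: tailed_clique_def)
  from e obtain i j where ij: "i < n" "j < n" "i \<noteq> j" "e = {i, j}"
    unfolding complete_graph_edges_iff by blast
  from or consider "i < s \<and> j < s" | "i = 0" | "j = 0" using ij(4) by auto
  then show ?thesis
    using that[of i j] that[of j i] ij by cases (simp_all add: insert_commute)
qed

lemma connected_tailed_clique: "connected_graph {..<n} (tailed_clique s n)"
proof -
  have 1: "(0, i) \<in> (adj_rel (tailed_clique s n))\<^sup>*" "(i, 0) \<in> (adj_rel (tailed_clique s n))\<^sup>*"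
    if "i < n" for i
  proof -
    show "(0, i) \<in> (adj_rel (tailed_clique s n))\<^sup>*"
      using root_edge[of i n s] that by (cases "i = 0") (auto simp: adj_rel_def)
    show "(i, 0) \<in> (adj_rel (tailed_clique s n))\<^sup>*"
      using root_edge[of i n s] that by (cases "i = 0") (auto simp: adj_rel_def insert_commute)
  qed
  show ?thesis
    unfolding connected_graph_def using 1 rtrancl_trans by (metis lessThan_iff)
qed

lemma chromatic_tailed_clique:
  assumes "s \<le> n"
  shows "s \<le> chromatic_number {..<n} (tailed_clique s n)"
proof -
  \<comment> \<open>The colouring \<open>id\<close> shows that the \<open>LEAST\<close> is
    attained.\<close>
  have "colourable {..<n} (tailed_clique s n) n"
    unfolding colourable_def
    by (rule exI[of _ id]) (auto simp: tailed_clique_def complete_graph_edges_def)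
  then have "colourable {..<n} (tailed_clique s n) (chromatic_number {..<n} (tailed_clique s n))"
    unfolding chromatic_number_def by (rule LeastI)
  then obtain c where c: "c ` {..<n} \<subseteq> {..<chromatic_number {..<n} (tailed_clique s n)}"
    and col: "\<forall>u\<in>{..<n}. \<forall>v\<in>{..<n}. {u, v} \<in> tailed_clique s n \<longrightarrow> c u \<noteq> c v"
    unfolding colourable_def by (elim exE conjE) rule
  have "inj_on c {..<s}"
  proof (rule inj_onI, rule ccontr)
    fix u v assume uv: "u \<in> {..<s}" "v \<in> {..<s}" "c u = c v" "u \<noteq> v"
    then have "{u, v} \<in> complete_graph_edges s" unfolding complete_graph_edges_iff by blast
    then have "{u, v} \<in> tailed_clique s n" using complete_subset_tailed_clique[OF assms] by blast
    with col uv assms show False by simp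
  qed
  moreover have "c ` {..<s} \<subseteq> {..<chromatic_number {..<n} (tailed_clique s n)}"
    by (rule subset_trans[OF image_mono c]) (use assms in auto)
  ultimately show ?thesis
    using card_inj_on_le[of c "{..<s}" "{..<chromatic_number {..<n} (tailed_clique s n)}"] by simp
qed

text \<open>Of the at least \<open>n - 1\<close> neighbours of \<open>v\<close> in colour
  \<open>b\<close>, at most \<open>s - 1\<close> lie in \<open>S\<close>, so \<open>n - s\<close> of
  them remain as leaves.\<close>

lemma mono_copy_tailed_clique:
  assumes S: "S \<subseteq> {..<N}" "card S = s" "mono_clique col b S" and v: "v \<in> S"
    and deg: "n \<le> Suc (card (nbhd col b {..<N} v))" and "s \<le> n"
  shows "mono_copy {..<n} (tailed_clique s n) N col"
proof -
  have fin: "finite S" using S(1) finite_subset by blast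
  then have "s \<ge> 1" using S(2) v by (metis One_nat_def Suc_leI card_gt_0_iff empty_iff)
  let ?nb = "nbhd col b {..<N} v"
  have "card (?nb - (S - {v})) \<ge> card ?nb - card (S - {v})"
    using fin by (intro diff_card_le_card_Diff) auto
  then have "n - s \<le> card (?nb - (S - {v}))"
    using deg \<open>s \<ge> 1\<close> card_Diff_singleton[OF v] S(2) by linarith
  then obtain L where L: "L \<subseteq> ?nb - (S - {v})" "card L = n - s" "finite L"
    using obtain_subset_with_card_n by metis
  have "v \<notin> ?nb" by (simp add: nbhd_def)
  then have disj: "L \<inter> S = {}" using L(1) by auto
  have "card {1..<s} = card (S - {v})" using S(2) v fin by simp
  then obtain g where g: "bij_betw g {1..<s} (S - {v})"
    using finite_same_card_bij[of "{1..<s}" "S - {v}"] fin by auto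
  have "card {s..<n} = card L" using L(2) by simp
  then obtain h where h: "bij_betw h {s..<n} L"
    using finite_same_card_bij[of "{s..<n}" L] L(3) by auto
  \<comment> \<open>The root goes to \<open>v\<close>; \<open>g\<close> places the rest of the
    clique and \<open>h\<close> the leaves.\<close>
  define \<phi> where "\<phi> = (\<lambda>i. if i = 0 then v else if i < s then g i else h i)"
  have \<phi>0: "\<phi> 0 = v" by (simp add: \<phi>_def)
  have \<phi>g: "\<phi> i = g i" "\<phi> i \<in> S - {v}" if "1 \<le> i" "i < s" for i
    using that bij_betwE[OF g] by (auto simp: \<phi>_def)
  have \<phi>h: "\<phi> i = h i" "\<phi> i \<in> L" if "s \<le> i" "i < n" for i
    using that bij_betwE[OF h] \<open>s \<ge> 1\<close> by (auto simp: \<phi>_def)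
  have \<phi>S: "\<phi> i \<in> S" if "i < s" for i
    using that \<phi>0 \<phi>g(2)[of i] v by (cases "i = 0") auto
  have inj_S: "inj_on \<phi> {..<s}"
  proof (rule inj_onI)
    fix i j assume "i \<in> {..<s}" "j \<in> {..<s}" "\<phi> i = \<phi> j"
    then show "i = j"
      using \<phi>0 \<phi>g[of i] \<phi>g[of j] bij_betw_imp_inj_on[OF g]
      by (cases "i = 0"; cases "j = 0") (auto dest: inj_onD)
  qed
  have inj_L: "inj_on \<phi> {s..<n}"
    using bij_betw_imp_inj_on[OF h] \<phi>h(1) by (simp add: inj_on_def)
  have "inj_on \<phi> ({..<s} \<union> {s..<n})"
    using inj_S inj_L \<phi>S \<phi>h(2) disj by (subst inj_on_Un) fastforce
  moreover have "{..<s} \<union> {s..<n} = {..<n}" using \<open>s \<le> n\<close> by auto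
  ultimately have inj: "inj_on \<phi> {..<n}" by simp
  have "\<phi> i < N" if "i < n" for i
  proof (cases "i < s")
    case True
    with \<phi>S[OF True] S(1) show ?thesis by auto
  next
    case False
    with that have "\<phi> i \<in> L" by (intro \<phi>h(2)) auto
    with L(1) have "\<phi> i \<in> ?nb" by auto
    then show ?thesis by (simp add: nbhd_def)
  qed
  then have ran: "\<phi> ` {..<n} \<subseteq> {..<N}" by auto
  have "col (\<phi> ` e) = b" if "e \<in> tailed_clique s n" for e
    using that
  proof (rule tailed_clique_edgeE)
    fix i j assume ij: "i < n" "j < n" "i \<noteq> j" "e = {i, j}" "i < s \<and> j < s \<or> i = 0"
    have ne: "\<phi> i \<noteq> \<phi> j" using inj ij by (simp add: inj_on_eq_iff)
    show ?thesis
    proof (cases "i < s \<and> j < s")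
      case True
      then show ?thesis using S(3) \<phi>S ne ij(4) by (simp add: mono_clique_def)
    next
      case False
      then have "i = 0" "s \<le> j" using ij(5) \<open>s \<ge> 1\<close> by auto
      then have "\<phi> i = v" "\<phi> j \<in> ?nb" using \<phi>0 \<phi>h(2)[of j] ij(2) L(1) by auto
      then show ?thesis using ij(4) by (simp add: nbhd_def)
    qed
  qed
  with inj ran show ?thesis
    unfolding mono_copy_def by (intro exI[of _ \<phi>] exI[of _ b] conjI ballI)
qed

text \<open>Choosing \<open>v\<close> discards \<open>v\<close> and its fewer than \<open>d\<close>
  neighbours in colour \<open>b\<close>, at most \<open>d\<close> vertices in all, so
  \<open>s * d\<close> vertices allow \<open>s\<close> choices.\<close>

lemma greedy_clique:
  assumes "d > 0" "finite X" "\<And>v. v \<in> X \<Longrightarrow> card (nbhd col b X v) < d" "s * d \<le> card X"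
  shows "\<exists>S\<subseteq>X. card S = s \<and> mono_clique col (\<not> b) S"
  using assms(2-4)
proof (induction s arbitrary: X)
  case 0
  then show ?case by (auto simp: mono_clique_def intro!: exI[of _ "{}"])
next
  case (Suc s)
  have "card X > 0" using Suc.prems(3) \<open>d > 0\<close> by (simp add: add_pos_nonneg less_le_trans)
  then obtain v where v: "v \<in> X" by fastforce
  let ?X = "nbhd col (\<not> b) X v"
  have "card (nbhd col b X v) + card ?X = card X - 1"
    using card_nbhd_split[OF Suc.prems(1), of col b v] v Suc.prems(1) by simp
  then have "s * d \<le> card ?X"
    using Suc.prems(2)[OF v] Suc.prems(3) by simp
  moreover have "card (nbhd col b ?X w) < d" if "w \<in> ?X" for w
  proof -
    have "w \<in> X" using that by (simp add: nbhd_def)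
    have "card (nbhd col b ?X w) \<le> card (nbhd col b X w)"
      using Suc.prems(1) by (intro card_mono finite_nbhd) (auto simp: nbhd_def)
    also have "\<dots> < d" using \<open>w \<in> X\<close> by (rule Suc.prems(2))
    finally show ?thesis .
  qed
  moreover have "finite ?X" using Suc.prems(1) by (rule finite_nbhd)
  ultimately obtain S where S: "S \<subseteq> ?X" "card S = s" "mono_clique col (\<not> b) S"
    using Suc.IH[of ?X] by blast
  have "card (insert v S) = Suc s" using card_insert_nbhd[OF Suc.prems(1) S(1)] S(2) by simp
  moreover have "insert v S \<subseteq> X" using v S(1) nbhd_subset[of col "\<not> b" X v] by auto
  ultimately show ?case
    using mono_clique_insert[OF S(3) S(1)] by (intro exI[of _ "insert v S"] conjI)
qed

section \<open>Upper and lower Ramsey bounds for tailed cliques\<close>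

lemma ramsey_tailed_clique_upper:
  assumes "1 \<le> s" "s \<le> n"
  shows "ramsey_number {..<n} (tailed_clique s n) \<le> clique_ramsey s + 2 * (s * n)"
proof (rule ramsey_number_le)
  fix col
  define N where "N = clique_ramsey s + 2 * (s * n)"
  \<comment> \<open>The vertices with fewer than \<open>n - 1\<close> neighbours in colour
    \<open>b\<close>, too few for a root.\<close>
  define low where "low = (\<lambda>b. {v \<in> {..<N}. Suc (card (nbhd col b {..<N} v)) < n})"
  have fin: "finite (low b)" and sub: "low b \<subseteq> {..<N}" for b by (auto simp: low_def)
  have "n \<le> s * n" "n > 0" using assms by auto
  show "mono_copy {..<n} (tailed_clique s n) N col"
  proof (cases "\<exists>b. s * n \<le> card (low b)")
    case True
    \<comment> \<open>The greedy clique has the colour opposite to \<open>b\<close>. Its vertices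
      are low in \<open>b\<close>, so \<open>2 * n \<le> N\<close> makes their degree in the
      opposite colour large enough for a root.\<close>
    then obtain b where b: "s * n \<le> card (low b)" by blast
    have "card (nbhd col b (low b) v) < n" if "v \<in> low b" for v
    proof -
      have "card (nbhd col b (low b) v) \<le> card (nbhd col b {..<N} v)"
        using sub[of b] by (intro card_mono finite_nbhd) (auto simp: nbhd_def)
      with that show ?thesis by (simp add: low_def)
    qed
    from greedy_clique[OF \<open>n > 0\<close> fin this b]
    obtain S where S: "S \<subseteq> low b" "card S = s" "mono_clique col (\<not> b) S" by blast
    then obtain v where v: "v \<in> S" using assms(1) by fastforce
    have "v \<in> low b" using v S(1) by blast
    then have "card (nbhd col b {..<N} v) + card (nbhd col (\<not> b) {..<N} v) = N - 1"
      using card_nbhd_split[of "{..<N}" col b v] by (simp add: low_def)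
    moreover have "Suc (card (nbhd col b {..<N} v)) < n"
      using \<open>v \<in> low b\<close> by (simp add: low_def)
    moreover have "2 * n \<le> N" using \<open>n \<le> s * n\<close> unfolding N_def by linarith
    ultimately have "n \<le> Suc (card (nbhd col (\<not> b) {..<N} v))" by linarith
    with S v assms(2) sub[of b] show ?thesis
      by (intro mono_copy_tailed_clique[of S]) auto
  next
    case False
    \<comment> \<open>Fewer than \<open>2 * (s * n)\<close> vertices are low in some colour. Enough
      remain to contain a clique, and any of its vertices can be the root, whatever the
      colour.\<close>
    then have "card (low b) < s * n" for b by (metis not_le)
    from this[of True] this[of False]
    have "clique_ramsey s \<le> card {..<N} - card (low True \<union> low False)"
      using card_Un_le[of "low True" "low False"] unfolding N_def card_lessThan by linarith
    also have "\<dots> \<le> card ({..<N} - (low True \<union> low False))"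
      using fin by (intro diff_card_le_card_Diff) auto
    finally have "clique_ramsey s \<le> card ({..<N} - (low True \<union> low False))" .
    then obtain S b where S: "S \<subseteq> {..<N} - (low True \<union> low False)" "card S = s" "mono_clique col b S"
      using mono_clique_exists[of "{..<N} - (low True \<union> low False)" s col] by auto
    then obtain v where v: "v \<in> S" using assms(1) by fastforce
    have "v \<in> {..<N}" "v \<notin> low b" using v S(1) by (cases b; auto)+
    then have "n \<le> Suc (card (nbhd col b {..<N} v))" by (simp add: low_def)
    with S v assms(2) show ?thesis
      by (intro mono_copy_tailed_clique[of S]) auto
  qed
qed

lemma ramsey_tailed_clique_ge_clique:
  "s \<le> n \<Longrightarrow> clique_ramsey s \<le> ramsey_number {..<n} (tailed_clique s n)"
  by (intro ramsey_number_subgraph graph_on_tailed_clique complete_subset_tailed_clique) auto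

text \<open>In the colour inside the blocks, the root and its neighbours would put \<open>n\<close>
  vertices into one block of size \<open>n - 1\<close>; in the other colour, the \<open>s\<close>
  clique vertices would need distinct blocks among \<open>s - 1\<close>.\<close>

lemma ramsey_tailed_clique_lower:
  assumes "2 \<le> s" "s \<le> n"
  shows "(s - 1) * (n - 1) < ramsey_number {..<n} (tailed_clique s n)"
proof (rule ramsey_number_less[OF graph_on_tailed_clique])
  define d where "d = n - 1"
  have "d > 0" using assms by (simp add: d_def)
  \<comment> \<open>Chvatal's colouring: \<open>s - 1\<close> disjoint cliques on \<open>n - 1\<close> vertices each, the other colour in between\<close>
  define col where "col = (\<lambda>e :: nat set. \<exists>q. \<forall>x\<in>e. x div d = q)"
  have col: "col {x, y} \<longleftrightarrow> x div d = y div d" for x y by (auto simp: col_def)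
  show "\<not> mono_copy {..<n} (tailed_clique s n) ((s - 1) * (n - 1)) col"
  proof
    assume "mono_copy {..<n} (tailed_clique s n) ((s - 1) * (n - 1)) col"
    then obtain \<phi> b where inj: "inj_on \<phi> {..<n}" and ran: "\<phi> ` {..<n} \<subseteq> {..<(s - 1) * (n - 1)}"
      and b: "\<forall>e\<in>tailed_clique s n. col (\<phi> ` e) = b"
      unfolding mono_copy_def by (elim exE conjE) rule
    show False
    proof (cases b)
      case True
      define q where "q = \<phi> 0 div d"
      have "\<phi> i div d = q" if "i < n" for i
      proof (cases "i = 0")
        case False
        then have "col (\<phi> ` {0, i})" using b root_edge[of i n s] that True by blast
        then show ?thesis by (simp add: col q_def)
      qed (simp add: q_def)
      then have "\<phi> i \<in> {q * d..<q * d + d}" if "i < n" for i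
        using that div_mult_mod_eq[of "\<phi> i" d] mod_less_divisor[OF \<open>d > 0\<close>, of "\<phi> i"]
        unfolding atLeastLessThan_iff by (metis add_less_cancel_left le_add1)
      then have "\<phi> ` {..<n} \<subseteq> {q * d..<q * d + d}" by auto
      then have "n \<le> d" using card_inj_on_le[OF inj, of "{q * d..<q * d + d}"] by simp
      then show False using assms by (simp add: d_def)
    next
      case False
      have "inj_on (\<lambda>i. \<phi> i div d) {..<s}"
      proof (rule inj_onI, rule ccontr)
        fix i j assume ij: "i \<in> {..<s}" "j \<in> {..<s}" "\<phi> i div d = \<phi> j div d" "i \<noteq> j"
        then have "{i, j} \<in> complete_graph_edges s" unfolding complete_graph_edges_iff by blast
        then have "{i, j} \<in> tailed_clique s n" using complete_subset_tailed_clique[OF assms(2)] by blast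
        then have "\<not> col (\<phi> ` {i, j})" using b False by blast
        then show False using ij(3) by (simp add: col)
      qed
      moreover have "(\<lambda>i. \<phi> i div d) ` {..<s} \<subseteq> {..<s - 1}"
      proof
        fix x assume "x \<in> (\<lambda>i. \<phi> i div d) ` {..<s}"
        then obtain i where "i < s" "x = \<phi> i div d" by auto
        moreover from \<open>i < s\<close> have "\<phi> i \<in> \<phi> ` {..<n}" using assms(2) by auto
        then have "\<phi> i < (s - 1) * d" using ran unfolding d_def by blast
        ultimately show "x \<in> {..<s - 1}" by (simp add: less_mult_imp_div_less)
      qed
      ultimately have "s \<le> s - 1" using card_inj_on_le[of "\<lambda>i. \<phi> i div d" "{..<s}" "{..<s - 1}"] by simp
      then show False using assms(1) by simp
    qed
  qed
qed

section \<open>Interpolation by the clique size\<close>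

text \<open>The additive error \<open>2 * (Suc s * n)\<close> is at most
  \<open>12 * ((s - 1) * (n - 1))\<close>, as \<open>s + 1 \<le> 3 * (s - 1)\<close> and
  \<open>n \<le> 2 * (n - 1)\<close>; the lower bound above thus turns it into a constant
  factor.\<close>

lemma ramsey_tailed_clique_step:
  assumes "2 \<le> s" "Suc s \<le> n" and C: "clique_ramsey (Suc s) \<le> C * clique_ramsey s"
  shows "ramsey_number {..<n} (tailed_clique (Suc s) n) \<le> (C + 12) * ramsey_number {..<n} (tailed_clique s n)"
proof -
  let ?R = "ramsey_number {..<n} (tailed_clique s n)"
  have "Suc s * n \<le> (3 * (s - 1)) * (2 * (n - 1))"
    using assms(1,2) by (intro mult_le_mono) linarith+
  also have "\<dots> = 6 * ((s - 1) * (n - 1))" by simp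
  also have "\<dots> \<le> 6 * ?R"
    using ramsey_tailed_clique_lower[of s n] assms(1,2) by (intro mult_le_mono2) simp
  finally have "2 * (Suc s * n) \<le> 12 * ?R" by linarith
  moreover have "clique_ramsey (Suc s) \<le> C * ?R"
    using ramsey_tailed_clique_ge_clique[of s n] assms(2) by (intro order_trans[OF C] mult_le_mono2) simp
  ultimately show ?thesis
    using ramsey_tailed_clique_upper[of "Suc s" n] assms(1,2) unfolding add_mult_distrib by linarith
qed

text \<open>Take the least \<open>s \<ge> k\<close> whose Ramsey number reaches \<open>m\<close>;
  the complete graph, \<open>s = n\<close>, is a candidate. Either \<open>s = k\<close>, where the
  Ramsey number is linear in \<open>n\<close>, or the predecessor stays below \<open>m\<close> and
  one step costs a bounded factor.\<close>

lemma tailed_clique_interpolation: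
  assumes "2 \<le> k" "k \<le> n" "n \<le> m" "m \<le> clique_ramsey n"
    and C: "\<And>s. s \<ge> 1 \<Longrightarrow> clique_ramsey (Suc s) \<le> C * clique_ramsey s"
  shows "\<exists>s\<ge>k. s \<le> n \<and> m \<le> ramsey_number {..<n} (tailed_clique s n) \<and>
    ramsey_number {..<n} (tailed_clique s n) \<le> (clique_ramsey k + 2 * k + C + 12) * m"
proof -
  let ?R = "\<lambda>s. ramsey_number {..<n} (tailed_clique s n)"
  let ?P = "\<lambda>s. k \<le> s \<and> s \<le> n \<and> m \<le> ?R s"
  define s where "s = (LEAST s. ?P s)"
  have "?P n" using assms by (simp add: tailed_clique_same)
  then have s: "?P s" unfolding s_def by (rule LeastI)
  have "?R s \<le> (clique_ramsey k + 2 * k + C + 12) * m"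
  proof (cases "s = k")
    case True
    have "?R k \<le> clique_ramsey k + 2 * (k * n)"
      using assms by (intro ramsey_tailed_clique_upper) auto
    \<comment> \<open>Here \<open>n \<le> m\<close>, and \<open>1 \<le> m\<close> lets the constant
      term be multiplied by \<open>m\<close>.\<close>
    also have "\<dots> \<le> clique_ramsey k * m + 2 * (k * m)"
      using assms by (intro add_mono mult_le_mono) auto
    also have "\<dots> \<le> (clique_ramsey k + 2 * k + C + 12) * m" by (simp add: add_mult_distrib)
    finally show ?thesis using True by simp
  next
    case False
    then obtain s' where s': "s = Suc s'" "k \<le> s'" using s by (cases s) auto
    have "\<not> ?P s'" using not_less_Least[of s' ?P] s' unfolding s_def by simp
    then have "?R s' \<le> m" using s s' by auto
    have "?R s \<le> (C + 12) * ?R s'"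
      using ramsey_tailed_clique_step[OF _ _ C] s s' assms(1) by simp
    also have "\<dots> \<le> (clique_ramsey k + 2 * k + C + 12) * m"
      using \<open>?R s' \<le> m\<close> by (intro mult_le_mono) auto
    finally show ?thesis .
  qed
  with s show ?thesis by blast
qed

theorem theorem5p2:
  fixes k :: nat
  assumes "k \<ge> 2"
  shows "\<exists>(c::real) (C::real) (n0::nat). c > 0 \<and> C > 0 \<and>
    (\<forall>f :: nat \<Rightarrow> nat.
       mono_on {1..} f \<and>
       (\<forall>n\<ge>1. n \<le> f n \<and> f n \<le> ramsey_number {..<n} (complete_graph_edges n))
       \<longrightarrow> (\<exists>G :: nat \<Rightarrow> nat set set.
              (\<forall>n\<ge>1. graph_on {..<n} (G n) \<and> connected_graph {..<n} (G n) \<and>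
                     c * real (f n) \<le> real (ramsey_number {..<n} (G n)) \<and>
                     real (ramsey_number {..<n} (G n)) \<le> C * real (f n)) \<and>
              (\<forall>n\<ge>max 1 n0. chromatic_number {..<n} (G n) \<ge> k)))"
proof -
  obtain D where D: "\<And>s. s \<ge> 1 \<Longrightarrow> clique_ramsey (Suc s) \<le> D * clique_ramsey s"
    using clique_ramsey_growth by blast
  define C where "C = clique_ramsey k + 2 * k + D + 12"
  have main: "\<exists>s\<le>n. f \<le> ramsey_number {..<n} (tailed_clique s n) \<and>
      ramsey_number {..<n} (tailed_clique s n) \<le> C * f \<and> (k \<le> n \<longrightarrow> k \<le> s)"
    if "1 \<le> n" "n \<le> f" "f \<le> clique_ramsey n" for n f
  proof (cases "k \<le> n")
    case True
    then show ?thesis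
      using tailed_clique_interpolation[OF assms True that(2,3) D] unfolding C_def by blast
  next
    case False
    \<comment> \<open>Below \<open>k\<close> the complete graph itself is taken; its Ramsey number
      is at most the constant \<open>clique_ramsey k\<close>.\<close>
    have "clique_ramsey n \<le> clique_ramsey k * 1" using clique_ramsey_mono[of n k] False by simp
    also have "\<dots> \<le> C * f" using that by (intro mult_le_mono) (auto simp: C_def)
    finally show ?thesis using that(3) False by (intro exI[of _ n]) (simp add: tailed_clique_same)
  qed
  show ?thesis
  \<comment> \<open>The lower constant is 1 because the chosen Ramsey numbers are at least
    \<open>f n\<close>; from \<open>n = k\<close> on, the clique has at least \<open>k\<close>
    vertices.\<close>
  proof (rule exI[of _ "1::real"], rule exI[of _ "real C"], rule exI[of _ k], intro conjI allI impI)
    show "real C > 0" by (simp add: C_def)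
    fix f :: "nat \<Rightarrow> nat"
    assume "mono_on {1..} f \<and> (\<forall>n\<ge>1. n \<le> f n \<and> f n \<le> clique_ramsey n)"
    then have "\<forall>n. \<exists>s. n \<ge> 1 \<longrightarrow> s \<le> n \<and> f n \<le> ramsey_number {..<n} (tailed_clique s n) \<and>
        ramsey_number {..<n} (tailed_clique s n) \<le> C * f n \<and> (k \<le> n \<longrightarrow> k \<le> s)"
      using main by meson
    then obtain s where s: "\<And>n. n \<ge> 1 \<Longrightarrow> s n \<le> n \<and> f n \<le> ramsey_number {..<n} (tailed_clique (s n) n) \<and>
        ramsey_number {..<n} (tailed_clique (s n) n) \<le> C * f n \<and> (k \<le> n \<longrightarrow> k \<le> s n)"
      by metis
    show "\<exists>G. (\<forall>n\<ge>1. graph_on {..<n} (G n) \<and> connected_graph {..<n} (G n) \<and>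
                     1 * real (f n) \<le> real (ramsey_number {..<n} (G n)) \<and>
                     real (ramsey_number {..<n} (G n)) \<le> real C * real (f n)) \<and>
              (\<forall>n\<ge>max 1 k. chromatic_number {..<n} (G n) \<ge> k)"
    proof (intro exI[of _ "\<lambda>n. tailed_clique (s n) n"] conjI allI impI)
      fix n :: nat assume "n \<ge> 1"
      note s = s[OF this]
      show "graph_on {..<n} (tailed_clique (s n) n)" by (rule graph_on_tailed_clique)
      show "connected_graph {..<n} (tailed_clique (s n) n)" by (rule connected_tailed_clique)
      show "1 * real (f n) \<le> real (ramsey_number {..<n} (tailed_clique (s n) n))" using s by simp
      show "real (ramsey_number {..<n} (tailed_clique (s n) n)) \<le> real C * real (f n)"
        using s by (simp flip: of_nat_mult)
    next
      fix n :: nat assume "n \<ge> max 1 k"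
      then show "k \<le> chromatic_number {..<n} (tailed_clique (s n) n)"
        using s[of n] chromatic_tailed_clique[of "s n" n] by simp
    qed
  qed simp
qed

end
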